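(* Let $E$ be a nonzero reflexive real Banach space and let $S\colon E\rightrightarrows E^*$ and $T\colon E^*\rightrightarrows E$ be maximally monotone. Suppose that either (i) $\pi_1\,\mathrm{dom}\,\varphi_T=E^*$ and there exists $w^*\in E^*$ with $E\times\{w^*\}\subset\mathrm{dom}\,\varphi_S$, or (ii) $\pi_1\,\mathrm{dom}\,\varphi_S=E$ and there exists $w\in E$ with $E^*\times\{w\}\subset\mathrm{dom}\,\varphi_T$. Then $(I_E+TS)(E)=E$.
   Context: Since $E$ is reflexive, $T$ is regarded as a multifunction from $E^*$ into $E=E^{**}$, with graph $G(T)\subset E^*\times E$; monotonicity of $T$ means $\langle t_1-t_2,t_1^*-t_2^*\rangle\ge0$ for $(t_1^*,t_1),(t_2^*,t_2)\in G(T)$. Fitzpatrick functions: $\varphi_S(x,x^* ):=\sup_{(s,s^* )\in G(S)}[\langle x,s^*\rangle+\langle s,x^*\rangle-\langle s,s^*\rangle]$ on $E\times E^*$, and $\varphi_T(x^*,x):=\sup_{(t^*,t)\in G(T)}[\langle x,t^*\rangle+\langle t,x^*\rangle-\langle t,t^*\rangle]$ on $E^*\times E$; $\mathrm{dom}$ is the set where the function is finite and $\pi_1$ the first-coordinate projection. $TSx:=\bigcup_{y^*\in Sx}Ty^*$, $(I_E+TS)x:=\{x+z\colon z\in TSx\}$, $(I_E+TS)(E):=\bigcup_{x\in E}(I_E+TS)x$. *)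

theory Defs
  imports "HOL-Analysis.Analysis"
begin

definition reflexive_space :: "'a::real_normed_vector itself \<Rightarrow> bool" where
  "reflexive_space _ \<longleftrightarrow>
     surj (\<lambda>x::'a. (Blinfun (\<lambda>f::'a \<Rightarrow>\<^sub>L real. blinfun_apply f x) :: ('a \<Rightarrow>\<^sub>L real) \<Rightarrow>\<^sub>L real))"

definition graphS :: "('a::real_normed_vector \<Rightarrow> ('a \<Rightarrow>\<^sub>L real) set) \<Rightarrow> ('a \<times> ('a \<Rightarrow>\<^sub>L real)) set" where
  "graphS S = {(x, xs). xs \<in> S x}"

definition graphT :: "(('a::real_normed_vector \<Rightarrow>\<^sub>L real) \<Rightarrow> 'a set) \<Rightarrow> (('a \<Rightarrow>\<^sub>L real) \<times> 'a) set" where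
  "graphT T = {(ts, t). t \<in> T ts}"

definition monotoneS :: "('a::real_normed_vector \<Rightarrow> ('a \<Rightarrow>\<^sub>L real) set) \<Rightarrow> bool" where
  "monotoneS S \<longleftrightarrow> (\<forall>(x, xs) \<in> graphS S. \<forall>(y, ys) \<in> graphS S.
      blinfun_apply (xs - ys) (x - y) \<ge> 0)"

definition max_monotoneS :: "('a::real_normed_vector \<Rightarrow> ('a \<Rightarrow>\<^sub>L real) set) \<Rightarrow> bool" where
  "max_monotoneS S \<longleftrightarrow> monotoneS S \<and>
     (\<forall>x xs. (\<forall>(y, ys) \<in> graphS S. blinfun_apply (xs - ys) (x - y) \<ge> 0) \<longrightarrow> xs \<in> S x)"

definition monotoneT :: "(('a::real_normed_vector \<Rightarrow>\<^sub>L real) \<Rightarrow> 'a set) \<Rightarrow> bool" where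
  "monotoneT T \<longleftrightarrow> (\<forall>(t1s, t1) \<in> graphT T. \<forall>(t2s, t2) \<in> graphT T.
      blinfun_apply (t1s - t2s) (t1 - t2) \<ge> 0)"

definition max_monotoneT :: "(('a::real_normed_vector \<Rightarrow>\<^sub>L real) \<Rightarrow> 'a set) \<Rightarrow> bool" where
  "max_monotoneT T \<longleftrightarrow> monotoneT T \<and>
     (\<forall>xs x. (\<forall>(ts, t) \<in> graphT T. blinfun_apply (xs - ts) (x - t) \<ge> 0) \<longrightarrow> x \<in> T xs)"

definition fitzS :: "('a::real_normed_vector \<Rightarrow> ('a \<Rightarrow>\<^sub>L real) set) \<Rightarrow> 'a \<Rightarrow> ('a \<Rightarrow>\<^sub>L real) \<Rightarrow> ereal" where
  "fitzS S x xs = (SUP (s, ss) \<in> graphS S.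
      ereal (blinfun_apply ss x + blinfun_apply xs s - blinfun_apply ss s))"

definition fitzT :: "(('a::real_normed_vector \<Rightarrow>\<^sub>L real) \<Rightarrow> 'a set) \<Rightarrow> ('a \<Rightarrow>\<^sub>L real) \<Rightarrow> 'a \<Rightarrow> ereal" where
  "fitzT T xs x = (SUP (ts, t) \<in> graphT T.
      ereal (blinfun_apply ts x + blinfun_apply xs t - blinfun_apply ts t))"

definition edom :: "('a \<Rightarrow> 'b \<Rightarrow> ereal) \<Rightarrow> ('a \<times> 'b) set" where
  "edom f = {(a, b). \<bar>f a b\<bar> \<noteq> \<infinity>}"

definition range_I_plus_TS ::
  "('a::real_normed_vector \<Rightarrow> ('a \<Rightarrow>\<^sub>L real) set) \<Rightarrow> (('a \<Rightarrow>\<^sub>L real) \<Rightarrow> 'a set) \<Rightarrow> 'a set" where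
  "range_I_plus_TS S T = (\<Union>x. {x + z | z. z \<in> (\<Union>ys \<in> S x. T ys)})"

end

(*
  Let F be the dual of E.  Fix x0 in E and put f(y,x) = phi_S(x,y) and
  g(y,x) = phi_T(y, x0 - x) - <x0,y> on the Banach space F x E.  Maximality gives f + g >= 0, and
  each of (i), (ii) gives dom f - dom g = F x E, so by the Attouch-Brezis version of Fenchel duality
  (Baire category plus Hahn-Banach) there is a continuous linear L with L(p - q) <= f(p) + g(q) for
  all p, q.  By reflexivity L is represented by some x in E and y in F.  Evaluating the inequality at
  points p, q coming from the graphs of S and T shows <x - s, y - s'> + <x0 - x - t, y - t'> >= 0
  whenever s' is in S(s) and t is in T(t'), and maximality of S and T forces y in S(x) and x0 - x
  in T(y).
*)
theory Submission
  imports Defs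
begin

section \<open>Sublinear functionals and the Hahn-Banach theorem\<close>

text \<open>Homogeneity is asked for only as an inequality: applying it with \<open>1 / c\<close>
  gives the reverse one. Each new functional below thus needs just one estimate.\<close>

definition sublinear :: "('a::real_vector \<Rightarrow> real) \<Rightarrow> bool" where
  "sublinear p \<longleftrightarrow> (\<forall>x y. p (x + y) \<le> p x + p y) \<and> (\<forall>c>0. \<forall>x. p (c *\<^sub>R x) \<le> c * p x)"

lemma sublinearI:
  assumes "\<And>x y. p (x + y) \<le> p x + p y" and "\<And>c x. c > 0 \<Longrightarrow> p (c *\<^sub>R x) \<le> c * p x"
  shows "sublinear p"
  using assms by (simp add: sublinear_def)

lemma sublinear_add: "sublinear p \<Longrightarrow> p (x + y) \<le> p x + p y"
  by (simp add: sublinear_def)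

lemma sublinear_scaleR:
  assumes "sublinear p" "c > 0"
  shows "p (c *\<^sub>R x) = c * p x"
proof -
  have "p ((1 / c) *\<^sub>R c *\<^sub>R x) \<le> (1 / c) * p (c *\<^sub>R x)"
    using assms unfolding sublinear_def by (metis zero_less_divide_1_iff)
  then have "c * p x \<le> p (c *\<^sub>R x)"
    using assms by (simp add: field_simps)
  moreover have "p (c *\<^sub>R x) \<le> c * p x"
    using assms by (simp add: sublinear_def)
  ultimately show ?thesis by simp
qed

lemma sublinear_zero: "sublinear p \<Longrightarrow> p 0 = 0"
  using sublinear_scaleR[of p 2 0] by simp

lemma sublinear_minus: "sublinear p \<Longrightarrow> - p (- x) \<le> p x"
  using sublinear_add[of p x "- x"] sublinear_zero[of p] by simp

text \<open>The chain condition is what saves subadditivity: the smaller \<open>s\<close> of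
  \<open>q\<close> and \<open>r\<close> satisfies
  \<open>s (x + y) \<le> s x + s y \<le> q x + r y\<close>, so the infima over \<open>q\<close> and
  \<open>r\<close> can be taken independently.\<close>

lemma sublinear_INF_chain:
  fixes C :: "('a::real_vector \<Rightarrow> real) set"
  assumes ne: "C \<noteq> {}" and sub: "\<And>q. q \<in> C \<Longrightarrow> sublinear q"
    and chain: "\<And>q r. q \<in> C \<Longrightarrow> r \<in> C \<Longrightarrow> (\<forall>x. q x \<le> r x) \<or> (\<forall>x. r x \<le> q x)"
    and bdd: "\<And>x. bdd_below ((\<lambda>q. q x) ` C)"
  shows "sublinear (\<lambda>x. INF q\<in>C. q x)"
proof (rule sublinearI)
  fix x y
  have *: "(INF q\<in>C. q (x + y)) \<le> q x + r y" if "q \<in> C" "r \<in> C" for q r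
  proof -
    obtain s where s: "s \<in> C" "s x \<le> q x" "s y \<le> r y"
      using chain[OF \<open>q \<in> C\<close> \<open>r \<in> C\<close>] \<open>q \<in> C\<close> \<open>r \<in> C\<close> by blast
    have "(INF q\<in>C. q (x + y)) \<le> s (x + y)"
      using bdd s by (intro cINF_lower)
    also have "\<dots> \<le> s x + s y"
      using sub s by (intro sublinear_add)
    finally show ?thesis using s by linarith
  qed
  have "(INF q\<in>C. q (x + y)) - r y \<le> (INF q\<in>C. q x)" if "r \<in> C" for r
    using ne *[OF _ that] by (intro cINF_greatest) (auto simp: algebra_simps)
  then have "(INF q\<in>C. q (x + y)) - (INF q\<in>C. q x) \<le> (INF q\<in>C. q y)"
    using ne by (intro cINF_greatest) (auto simp: algebra_simps)
  then show "(INF q\<in>C. q (x + y)) \<le> (INF q\<in>C. q x) + (INF q\<in>C. q y)"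
    by simp
next
  fix c :: real and x
  assume c: "c > 0"
  have "(INF q\<in>C. q (c *\<^sub>R x)) / c \<le> (INF q\<in>C. q x)"
  proof (rule cINF_greatest[OF ne])
    fix q assume q: "q \<in> C"
    have "(INF q\<in>C. q (c *\<^sub>R x)) \<le> q (c *\<^sub>R x)"
      using bdd q by (intro cINF_lower)
    then show "(INF q\<in>C. q (c *\<^sub>R x)) / c \<le> q x"
      using sublinear_scaleR[OF sub[OF q] c] c by (simp add: field_simps)
  qed
  then show "(INF q\<in>C. q (c *\<^sub>R x)) \<le> c * (INF q\<in>C. q x)"
    using c by (simp add: field_simps)
qed

lemma minimal_sublinear_imp_linear:
  fixes q :: "'a::real_vector \<Rightarrow> real"
  assumes q: "sublinear q" and min: "\<And>r. sublinear r \<Longrightarrow> \<forall>x. r x \<le> q x \<Longrightarrow> r = q"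
  shows "linear q"
proof -
  have add: "q (x + y) = q x + q y" for x y
  proof -
    \<comment> \<open>\<open>r \<le> q\<close> is sublinear, so \<open>r = q\<close>, and \<open>t = 1\<close> gives \<open>q x \<le> q (x + y) - q y\<close>.\<close>
    define r where "r x = (INF t\<in>{0..}. q (x + t *\<^sub>R y) - t * q y)" for x
    have bdd: "bdd_below ((\<lambda>t. q (x + t *\<^sub>R y) - t * q y) ` {0..})" for x
    proof (rule bdd_belowI2)
      fix t :: real assume "t \<in> {0..}"
      then have "q (t *\<^sub>R y) = t * q y"
        using sublinear_scaleR[OF q, of t y] sublinear_zero[OF q] by (cases "t = 0") auto
      moreover have "q (t *\<^sub>R y) \<le> q (x + t *\<^sub>R y) + q (- x)"
        using sublinear_add[OF q, of "x + t *\<^sub>R y" "- x"] by simp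
      ultimately show "- q (- x) \<le> q (x + t *\<^sub>R y) - t * q y" by simp
    qed
    have r_le: "r x \<le> q (x + t *\<^sub>R y) - t * q y" if "t \<ge> 0" for x t
      unfolding r_def using that bdd by (intro cINF_lower) auto
    have r_ge: "m \<le> r x" if "\<And>t. t \<ge> 0 \<Longrightarrow> m \<le> q (x + t *\<^sub>R y) - t * q y" for m x
      unfolding r_def using that by (intro cINF_greatest) auto
    have "sublinear r"
    proof (rule sublinearI)
      fix u v
      \<comment> \<open>The parameters add: the infimum for \<open>u + v\<close> is tested at
        \<open>t + s\<close>, after which \<open>t\<close> and \<open>s\<close> are minimised
        separately.\<close>
      have *: "r (u + v) \<le> (q (u + t *\<^sub>R y) - t * q y) + (q (v + s *\<^sub>R y) - s * q y)"
        if "t \<ge> 0" "s \<ge> 0" for t s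
        using r_le[of "t + s" "u + v"] that sublinear_add[OF q, of "u + t *\<^sub>R y" "v + s *\<^sub>R y"]
        by (simp add: algebra_simps)
      have "r (u + v) - (q (v + s *\<^sub>R y) - s * q y) \<le> r u" if "s \<ge> 0" for s
        using *[OF _ that] by (intro r_ge) (simp add: algebra_simps)
      then have "r (u + v) - r u \<le> r v"
        by (intro r_ge) (simp add: algebra_simps)
      then show "r (u + v) \<le> r u + r v" by simp
    next
      fix c :: real and u
      assume c: "c > 0"
      have "r (c *\<^sub>R u) / c \<le> r u"
      proof (rule r_ge)
        fix t :: real assume "t \<ge> 0"
        then have "r (c *\<^sub>R u) \<le> q (c *\<^sub>R (u + t *\<^sub>R y)) - c * t * q y"
          using r_le[of "c * t" "c *\<^sub>R u"] c by (simp add: algebra_simps)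
        also have "\<dots> = c * (q (u + t *\<^sub>R y) - t * q y)"
          by (simp only: sublinear_scaleR[OF q c]) (simp add: algebra_simps)
        finally show "r (c *\<^sub>R u) / c \<le> q (u + t *\<^sub>R y) - t * q y"
          using c by (simp add: pos_divide_le_eq mult.commute)
      qed
      then show "r (c *\<^sub>R u) \<le> c * r u"
        using c by (simp add: field_simps)
    qed
    moreover have "\<forall>x. r x \<le> q x"
      using r_le[of 0] by simp
    ultimately have "r = q" by (rule min)
    then have "q x \<le> q (x + y) - q y"
      using r_le[of 1 x] by simp
    then show ?thesis
      using sublinear_add[OF q, of x y] by simp
  qed
  \<comment> \<open>Additivity makes \<open>q\<close> odd, which carries positive homogeneity over
    to negative scalars.\<close>
  have neg: "q (- x) = - q x" for x
    using add[of x "- x"] sublinear_zero[OF q] by simp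
  have "q (c *\<^sub>R x) = c * q x" for c x
  proof (cases c "0::real" rule: linorder_cases)
    case less
    then show ?thesis
      using sublinear_scaleR[OF q, of "- c" x] neg[of "c *\<^sub>R x"] by simp
  qed (use q in \<open>auto simp: sublinear_scaleR sublinear_zero\<close>)
  with add show ?thesis by (intro linearI) auto
qed

text \<open>Instead of extending functionals from subspaces, Zorn's lemma is applied to the
  sublinear functionals below \<open>p\<close>; a minimal one is linear by the preceding
  lemma.\<close>

lemma hahn_banach_sublinear:
  fixes p :: "'a::real_vector \<Rightarrow> real"
  assumes p: "sublinear p"
  obtains L where "linear L" and "\<And>x. L x \<le> p x"
proof -
  define A where "A = {q. sublinear q \<and> (\<forall>x. q x \<le> p x)}"
  \<comment> \<open>The order is reversed, so the maximal element given by
    \<open>predicate_Zorn\<close> is a pointwise minimal functional.\<close>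
  let ?P = "\<lambda>q r :: 'a \<Rightarrow> real. \<forall>x. r x \<le> q x"
  have "\<exists>m\<in>A. \<forall>a\<in>A. ?P m a \<longrightarrow> a = m"
  proof (rule predicate_Zorn)
    show "partial_order_on A (relation_of ?P A)"
      by (rule partial_order_on_relation_ofI) (auto intro: order_trans simp: fun_eq_iff order_antisym)
  next
    fix C assume C: "C \<in> Chains (relation_of ?P A)"
    then have CA: "C \<subseteq> A" by (rule Chains_relation_of)
    show "\<exists>u\<in>A. \<forall>a\<in>C. ?P a u"
    proof (cases "C = {}")
      case True
      then show ?thesis using p unfolding A_def by auto
    next
      case False
      \<comment> \<open>The bound \<open>- p (- x)\<close> does not depend on \<open>q\<close>:
        \<open>- p (- x) \<le> - q (- x) \<le> q x\<close>.\<close>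
      have bdd: "bdd_below ((\<lambda>q. q x) ` C)" for x
      proof (rule bdd_belowI2)
        fix q assume "q \<in> C"
        then have "sublinear q" "q (- x) \<le> p (- x)" using CA by (auto simp: A_def)
        then show "- p (- x) \<le> q x" using sublinear_minus[of q x] by linarith
      qed
      let ?m = "\<lambda>x. INF q\<in>C. q x"
      have m_le: "?m x \<le> q x" if "q \<in> C" for q x
        using bdd that by (rule cINF_lower)
      have "sublinear ?m"
      proof (rule sublinear_INF_chain[OF False _ _ bdd])
        show "sublinear q" if "q \<in> C" for q using that CA by (auto simp: A_def)
        show "(\<forall>x. q x \<le> r x) \<or> (\<forall>x. r x \<le> q x)" if "q \<in> C" "r \<in> C" for q r
          using C that unfolding Chains_def relation_of_def by blast
      qed
      moreover have "?m x \<le> p x" for x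
      proof -
        obtain q where q: "q \<in> C" using False by blast
        then have "q x \<le> p x" using CA by (auto simp: A_def)
        with m_le[OF q] show ?thesis by (rule order_trans)
      qed
      ultimately have "?m \<in> A" by (simp add: A_def)
      then show ?thesis by (rule bexI[rotated]) (simp add: m_le)
    qed
  qed
  then obtain m where m: "m \<in> A" and min: "\<And>a. a \<in> A \<Longrightarrow> \<forall>x. a x \<le> m x \<Longrightarrow> a = m"
    by blast
  have "linear m"
  proof (rule minimal_sublinear_imp_linear)
    show "sublinear m" using m by (simp add: A_def)
    show "r = m" if "sublinear r" "\<forall>x. r x \<le> m x" for r
      using that m by (intro min) (auto simp: A_def intro: order_trans)
  qed
  then show ?thesis using m that by (auto simp: A_def)
qed

section \<open>Linear minorants of convex functions\<close>

text \<open>The infimum \<open>p u\<close> of the slopes \<open>r / t\<close> over points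
  \<open>(t *\<^sub>R u, r)\<close> of \<open>K\<close> with \<open>t > 0\<close> is sublinear. Any
  linear functional below \<open>p\<close> works, since \<open>t = 1\<close> gives
  \<open>p u \<le> r\<close> on \<open>K\<close>.\<close>

lemma linear_minorant_of_convex_epigraph:
  fixes K :: "('a::real_vector \<times> real) set"
  assumes K: "convex K" and total: "\<And>u. \<exists>r. (u, r) \<in> K"
    and nonneg: "\<And>r. (0, r) \<in> K \<Longrightarrow> r \<ge> 0"
  obtains L where "linear L" and "\<And>u r. (u, r) \<in> K \<Longrightarrow> L u \<le> r"
proof -
  define P where "P u = {r / t | r t. t > 0 \<and> (t *\<^sub>R u, r) \<in> K}" for u
  define p where "p u = Inf (P u)" for u
  have PI: "r / t \<in> P u" if "t > 0" "(t *\<^sub>R u, r) \<in> K" for r t u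
    using that unfolding P_def by blast
  have comb: "a + b \<in> P (u + v)" if ab: "a \<in> P u" "b \<in> P v" for a b u v
  proof -
    obtain r t where t: "a = r / t" "t > 0" "(t *\<^sub>R u, r) \<in> K" using ab by (auto simp: P_def)
    obtain r' t' where t': "b = r' / t'" "t' > 0" "(t' *\<^sub>R v, r') \<in> K" using ab by (auto simp: P_def)
    have r: "r = a * t" "r' = b * t'" using t t' by auto
    \<comment> \<open>The convex weights \<open>t' / (t + t')\<close> and
      \<open>t / (t + t')\<close> bring \<open>u\<close> and \<open>v\<close> to the common factor
      \<open>w\<close>, so the combined point has slope \<open>a + b\<close> along
      \<open>u + v\<close>.\<close>
    define w where "w = t * t' / (t + t')"
    have "(t' / (t + t')) *\<^sub>R (t *\<^sub>R u, r) + (t / (t + t')) *\<^sub>R (t' *\<^sub>R v, r') \<in> K"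
      using t t' by (intro convexD[OF K]) (auto simp flip: add_divide_distrib)
    also have "(t' / (t + t')) *\<^sub>R (t *\<^sub>R u, r) + (t / (t + t')) *\<^sub>R (t' *\<^sub>R v, r') =
      (w *\<^sub>R (u + v), w * (a + b))"
      using r by (simp add: w_def algebra_simps add_divide_distrib)
    finally have "(w *\<^sub>R (u + v), w * (a + b)) \<in> K" .
    moreover have "w > 0" using t t' by (simp add: w_def)
    ultimately show ?thesis using PI[of w "u + v" "w * (a + b)"] by simp
  qed
  have ne: "P u \<noteq> {}" for u
    using total[of u] PI[of 1 u] by auto
  have zero: "a \<ge> 0" if "a \<in> P 0" for a
    using that nonneg by (auto simp: P_def)
  \<comment> \<open>A slope along \<open>u\<close> plus a slope along \<open>- u\<close> is a slope
    along 0, hence nonnegative; any fixed slope along \<open>- u\<close> therefore bounds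
    \<open>P u\<close> from below.\<close>
  have bdd: "bdd_below (P u)" for u
  proof -
    obtain s where "s \<in> P (- u)" using ne by blast
    then have "- s \<le> a" if "a \<in> P u" for a
      using zero[of "a + s"] comb[OF that, of s "- u"] by simp
    then show ?thesis by (rule bdd_belowI)
  qed
  have p_le: "p u \<le> a" if "a \<in> P u" for u a
    unfolding p_def using that bdd by (rule cInf_lower)
  have p_ge: "m \<le> p u" if "\<And>a. a \<in> P u \<Longrightarrow> m \<le> a" for u m
    unfolding p_def using ne that by (rule cInf_greatest)
  have "sublinear p"
  proof (rule sublinearI)
    fix u v
    have "p (u + v) - b \<le> p u" if "b \<in> P v" for b
    proof (rule p_ge)
      fix a assume "a \<in> P u"
      with that show "p (u + v) - b \<le> a" using p_le[OF comb] by (simp add: algebra_simps)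
    qed
    then have "p (u + v) - p u \<le> p v"
      by (intro p_ge) (simp add: algebra_simps)
    then show "p (u + v) \<le> p u + p v" by simp
  next
    fix c :: real and u
    assume c: "c > 0"
    have "p (c *\<^sub>R u) / c \<le> p u"
    proof (rule p_ge)
      fix a assume "a \<in> P u"
      then obtain r t where t: "a = r / t" "t > 0" "(t *\<^sub>R u, r) \<in> K" by (auto simp: P_def)
      then have "r / (t / c) \<in> P (c *\<^sub>R u)" using c by (intro PI) auto
      moreover have "r / (t / c) = a * c" using t by simp
      ultimately have "p (c *\<^sub>R u) \<le> a * c" using p_le by metis
      then show "p (c *\<^sub>R u) / c \<le> a" using c by (simp add: pos_divide_le_eq)
    qed
    then show "p (c *\<^sub>R u) \<le> c * p u" using c by (simp add: field_simps)
  qed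
  then obtain L where L: "linear L" "\<And>x. L x \<le> p x" by (rule hahn_banach_sublinear) blast
  have "L u \<le> r" if "(u, r) \<in> K" for u r
    using L(2)[of u] p_le[OF PI[of 1 u r]] that by simp
  with L(1) show ?thesis by (rule that)
qed

section \<open>Convex series, Baire category and differences of convex sets\<close>

text \<open>The weights \<open>(1 / 2) ^ Suc k\<close> sum to 1, so the limit is an infinite convex
  combination; boundedness gives convergence and closedness keeps the limit in
  \<open>P\<close>.\<close>

lemma convex_half_power_series:
  fixes P :: "'a::banach set"
  assumes P: "convex P" "closed P" "bounded P" and x: "\<And>k::nat. x k \<in> P"
  obtains l where "(\<lambda>k. (1 / 2) ^ Suc k *\<^sub>R x k) sums l" and "l \<in> P"
proof -
  obtain B where B: "\<And>y. y \<in> P \<Longrightarrow> norm y \<le> B" using P(3) by (auto simp: bounded_iff)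
  have "summable (\<lambda>k. (1 / 2) ^ Suc k *\<^sub>R x k)"
  proof (rule summable_comparison_test')
    show "summable (\<lambda>k. (1 / 2) ^ Suc k * B)"
      using power_half_series by (intro summable_mult2) (auto simp: sums_iff)
    show "norm ((1 / 2) ^ Suc k *\<^sub>R x k) \<le> (1 / 2) ^ Suc k * B" for k
      using B[OF x, of k] by (simp add: mult_left_mono)
  qed
  then obtain l where l: "(\<lambda>k. (1 / 2) ^ Suc k *\<^sub>R x k) sums l" by (auto simp: summable_def)
  \<comment> \<open>The weight \<open>(1 / 2) ^ n\<close> missing from the partial sum is put on
    \<open>w\<close>, giving a true convex combination. The induction splits off the first term, so
    \<open>y\<close> must vary.\<close>
  have part: "(\<Sum>k<n. (1 / 2) ^ Suc k *\<^sub>R y k) + (1 / 2) ^ n *\<^sub>R w \<in> P"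
    if "\<And>k. y k \<in> P" "w \<in> P" for n y w
    using that
  proof (induction n arbitrary: y)
    case (Suc n)
    have "(\<Sum>k<n. (1 / 2) ^ Suc k *\<^sub>R y (Suc k)) + (1 / 2) ^ n *\<^sub>R w \<in> P"
      using Suc by auto
    then have "(1 / 2) *\<^sub>R y 0 + (1 / 2) *\<^sub>R ((\<Sum>k<n. (1 / 2) ^ Suc k *\<^sub>R y (Suc k)) + (1 / 2) ^ n *\<^sub>R w) \<in> P"
      using Suc by (intro convexD[OF P(1)]) auto
    then show ?case
      by (simp only: sum.lessThan_Suc_shift)
         (simp add: scaleR_sum_right scaleR_right_distrib add.assoc o_def)
  qed simp
  have "(\<lambda>n. (1 / 2 :: real) ^ n) \<longlonglongrightarrow> 0"
    by (rule LIMSEQ_power_zero) simp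
  from tendsto_add[OF l[unfolded sums_def] tendsto_scaleR[OF this tendsto_const]]
  have lim: "(\<lambda>n. (\<Sum>k<n. (1 / 2) ^ Suc k *\<^sub>R x k) + (1 / 2) ^ n *\<^sub>R x 0) \<longlonglongrightarrow> l + 0 *\<^sub>R x 0" .
  have "l + 0 *\<^sub>R x 0 \<in> P"
    by (rule closed_sequentially[OF P(2) part lim]) (rule x)+
  then have "l \<in> P" by simp
  with l show ?thesis by (rule that)
qed

text \<open>As in the open mapping theorem, successive approximation writes a point of the ball as
  \<open>\<Sum>k. 2 ^ - (k + 1) *\<^sub>R (p k - q k)\<close>; the series in \<open>P\<close> and in \<open>Q\<close> converge separately, so
  no closedness of the difference set is needed.\<close>

lemma ball_subset_difference_if_closure:
  fixes P Q :: "'a::banach set"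
  assumes P: "convex P" "closed P" "bounded P" and Q: "convex Q" "closed Q" "bounded Q"
    and e: "e > 0" "ball 0 e \<subseteq> closure {x - y | x y. x \<in> P \<and> y \<in> Q}"
  shows "ball 0 (e / 2) \<subseteq> {x - y | x y. x \<in> P \<and> y \<in> Q}"
proof
  fix u :: 'a assume u: "u \<in> ball 0 (e / 2)"
  have "\<exists>x y. x \<in> P \<and> y \<in> Q \<and> norm (v - (x - y)) < e / 2" if "norm v < e" for v
  proof -
    have "v \<in> ball 0 e" using that by simp
    with e(2) have "v \<in> closure {x - y | x y. x \<in> P \<and> y \<in> Q}" by (rule subsetD)
    then obtain z where "z \<in> {x - y | x y. x \<in> P \<and> y \<in> Q}" "dist z v < e / 2"
      unfolding closure_approachable using half_gt_zero[OF e(1)] by blast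
    then show ?thesis by (auto simp: dist_norm norm_minus_commute)
  qed
  then obtain f g where fg: "\<And>v. norm v < e \<Longrightarrow> f v \<in> P \<and> g v \<in> Q \<and> norm (v - (f v - g v)) < e / 2"
    by metis
  \<comment> \<open>\<open>v n\<close> is the remainder of \<open>u\<close> after \<open>n\<close>
    terms, magnified by \<open>2 ^ Suc n\<close> so that it stays in the ball of radius
    \<open>e\<close>; the start \<open>2 *\<^sub>R u\<close> uses the radius
    \<open>e / 2\<close>.\<close>
  define v where "v n = ((\<lambda>v. 2 *\<^sub>R (v - (f v - g v))) ^^ n) (2 *\<^sub>R u)" for n
  have vS: "v (Suc n) = 2 *\<^sub>R (v n - (f (v n) - g (v n)))" for n by (simp add: v_def)
  have ve: "norm (v n) < e" for n
  proof (induction n)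
    case 0
    then show ?case using u by (simp add: v_def)
  next
    case (Suc n)
    then show ?case using fg[of "v n"] by (simp add: vS)
  qed
  obtain a where a: "(\<lambda>k. (1 / 2) ^ Suc k *\<^sub>R f (v k)) sums a" "a \<in> P"
    by (rule convex_half_power_series[OF P]) (use fg ve in auto)
  obtain b where b: "(\<lambda>k. (1 / 2) ^ Suc k *\<^sub>R g (v k)) sums b" "b \<in> Q"
    by (rule convex_half_power_series[OF Q]) (use fg ve in auto)
  have tele: "(\<Sum>k<n. (1 / 2) ^ Suc k *\<^sub>R f (v k) - (1 / 2) ^ Suc k *\<^sub>R g (v k))
      = u - (1 / 2) ^ Suc n *\<^sub>R v n" for n
  proof (induction n)
    case 0
    show ?case by (simp add: v_def)
  next
    case (Suc n)
    then show ?case by (simp add: vS) (simp add: algebra_simps)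
  qed
  have "(\<lambda>n. (1 / 2) ^ Suc n *\<^sub>R v n) \<longlonglongrightarrow> 0"
  proof (rule Lim_null_comparison)
    show "\<forall>\<^sub>F n in sequentially. norm ((1 / 2) ^ Suc n *\<^sub>R v n) \<le> (1 / 2) ^ Suc n * e"
      using ve by (auto intro!: always_eventually mult_left_mono simp: less_imp_le)
    have "(\<lambda>n. (1 / 2) ^ Suc n * e) \<longlonglongrightarrow> 0 * e"
      by (intro tendsto_mult tendsto_const LIMSEQ_Suc LIMSEQ_power_zero) auto
    then show "(\<lambda>n. (1 / 2) ^ Suc n * e) \<longlonglongrightarrow> 0" by simp
  qed
  then have "(\<lambda>n. u - (1 / 2) ^ Suc n *\<^sub>R v n) \<longlonglongrightarrow> u - 0"
    by (intro tendsto_diff tendsto_const)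
  moreover have "(\<lambda>n. u - (1 / 2) ^ Suc n *\<^sub>R v n) \<longlonglongrightarrow> a - b"
    using sums_diff[OF a(1) b(1)] unfolding sums_def tele .
  ultimately have "u = a - b" using LIMSEQ_unique by fastforce
  with a b show "u \<in> {x - y | x y. x \<in> P \<and> y \<in> Q}" by blast
qed

lemma exists_closure_interior_if_Union_UNIV:
  fixes A :: "nat \<Rightarrow> 'a::banach set"
  assumes "(\<Union>n. A n) = UNIV"
  obtains n where "interior (closure (A n)) \<noteq> {}"
proof -
  have *: "interior (\<Union> (range (\<lambda>n. closure (A n)))) = {}" if "\<And>n. interior (closure (A n)) = {}"
  proof -
    have "Met_TC.mcomplete TYPE('a)" by (simp add: complete_UNIV)
    then have "Met_TC.mtopology interior_of (\<Union> (range (\<lambda>n. closure (A n)))) = {}"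
      by (rule Met_TC.metric_Baire_category_alt) (use that in auto)
    then show ?thesis by simp
  qed
  have "x \<in> \<Union> (range (\<lambda>n. closure (A n)))" for x
  proof -
    have "x \<in> (\<Union>n. A n)" by (simp add: assms)
    then obtain n where "x \<in> A n" by blast
    then have "x \<in> closure (A n)" by (rule subsetD[OF closure_subset])
    then show ?thesis by blast
  qed
  then have "\<Union> (range (\<lambda>n. closure (A n))) = UNIV" by blast
  with * have "\<exists>n. interior (closure (A n)) \<noteq> {}"
    by (metis interior_UNIV UNIV_not_empty)
  with that show ?thesis by blast
qed

text \<open>Baire gives a ball around some \<open>z\<close> in the closure of one difference set.
  Averaging with \<open>- z\<close>, which lies in another, recentres it at 0 and halves the radius;
  removing the closure halves it again.\<close>

lemma ball_subset_convex_difference: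
  fixes P Q :: "nat \<Rightarrow> 'a::banach set"
  assumes P: "\<And>n. convex (P n)" "\<And>n. closed (P n)" "\<And>n. bounded (P n)" "incseq P"
    and Q: "\<And>n. convex (Q n)" "\<And>n. closed (Q n)" "\<And>n. bounded (Q n)" "incseq Q"
    and UN: "\<And>u. \<exists>n. u \<in> {x - y | x y. x \<in> P n \<and> y \<in> Q n}"
  obtains n e where "e > 0" and "ball 0 e \<subseteq> {x - y | x y. x \<in> P n \<and> y \<in> Q n}"
proof -
  define A where "A n = {x - y | x y. x \<in> P n \<and> y \<in> Q n}" for n
  have conv: "convex (A n)" for n
  proof -
    have "A n = (\<Union>x\<in>P n. \<Union>y\<in>Q n. {x - y})" by (auto simp: A_def)
    then show ?thesis using convex_differences[OF P(1) Q(1)] by simp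
  qed
  have mono: "A m \<subseteq> A n" if "m \<le> n" for m n
    using incseqD[OF P(4) that] incseqD[OF Q(4) that] by (auto simp: A_def)
  have "(\<Union>n. A n) = UNIV" using UN by (auto simp: A_def)
  then obtain k where "interior (closure (A k)) \<noteq> {}" by (rule exists_closure_interior_if_Union_UNIV)
  then obtain z d where d: "d > 0" "ball z d \<subseteq> closure (A k)"
    unfolding mem_interior by (auto simp: mem_interior ex_in_conv[symmetric])
  obtain m where m: "- z \<in> A m" using UN[of "- z"] by (auto simp: A_def)
  define n where "n = max k m"
  have "ball 0 (d / 2) \<subseteq> closure (A n)"
  proof
    fix u :: 'a assume "u \<in> ball 0 (d / 2)"
    then have "2 *\<^sub>R u + z \<in> ball z d" by (simp add: dist_norm)
    then have 1: "2 *\<^sub>R u + z \<in> closure (A n)"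
      using d(2) closure_mono[OF mono, of k n] by (auto simp: n_def)
    have "- z \<in> closure (A n)"
      using m mono[of m n] closure_subset by (auto simp: n_def)
    with 1 have "(1 / 2) *\<^sub>R (2 *\<^sub>R u + z) + (1 / 2) *\<^sub>R (- z) \<in> closure (A n)"
      using convex_closure[OF conv] by (intro convexD) auto
    then show "u \<in> closure (A n)" by (simp add: algebra_simps)
  qed
  then have "ball 0 (d / 2 / 2) \<subseteq> {x - y | x y. x \<in> P n \<and> y \<in> Q n}"
    using d(1) P Q by (intro ball_subset_difference_if_closure) (auto simp: A_def)
  then show ?thesis using d(1) by (intro that[of "d / 2 / 2"]) auto
qed

section \<open>Fenchel duality for closed convex epigraphs\<close>

text \<open>\<open>C\<close> and \<open>D\<close> play the role of the epigraphs of two lower semicontinuous convex functions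
  whose domains have difference set the whole space.\<close>

lemma fenchel_separation:
  fixes C D :: "('a::banach \<times> real) set"
  assumes C: "convex C" "closed C" "\<And>x r s. (x, r) \<in> C \<Longrightarrow> r \<le> s \<Longrightarrow> (x, s) \<in> C"
    and D: "convex D" "closed D" "\<And>x r s. (x, r) \<in> D \<Longrightarrow> r \<le> s \<Longrightarrow> (x, s) \<in> D"
    and nonneg: "\<And>x r s. (x, r) \<in> C \<Longrightarrow> (x, s) \<in> D \<Longrightarrow> r + s \<ge> 0"
    and total: "\<And>u. \<exists>x r y s. (x, r) \<in> C \<and> (y, s) \<in> D \<and> u = x - y"
  obtains L where "bounded_linear L"
    and "\<And>x r y s. (x, r) \<in> C \<Longrightarrow> (y, s) \<in> D \<Longrightarrow> L (x - y) \<le> r + s"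
proof -
  \<comment> \<open>\<open>K\<close> acts as the epigraph of the value function: the infimum at
    \<open>u\<close> of the sum of both functions over all \<open>x - y = u\<close>. The assumption
    \<open>nonneg\<close> bounds it at 0.\<close>
  define K where "K = (\<lambda>(p, q). (fst p - fst q, snd p + snd q)) ` (C \<times> D)"
  have KI: "(x - y, r + s) \<in> K" if "(x, r) \<in> C" "(y, s) \<in> D" for x y r s
    using that by (force simp: K_def)
  have lin: "linear (\<lambda>(p, q). (fst p - fst q, snd p + snd q) :: 'a \<times> real)"
    by (rule linearI) (auto simp: algebra_simps)
  obtain L where L: "linear L" and LK: "\<And>u r. (u, r) \<in> K \<Longrightarrow> L u \<le> r"
  proof (rule linear_minorant_of_convex_epigraph[of K])
    show "convex K"
      unfolding K_def using lin convex_Times[OF C(1) D(1)] by (rule convex_linear_image)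
    show "\<exists>r. (u, r) \<in> K" for u using total[of u] KI by blast
    show "r \<ge> 0" if "(0, r) \<in> K" for r
      using that nonneg by (auto simp: K_def)
  qed (rule that)
  \<comment> \<open>One index \<open>n\<close> bounds both the norm and the function value. The sets
    are thus bounded, closed and convex, and they increase to the whole domain.\<close>
  define lev where "lev E n = cball 0 (real n) \<inter> (\<lambda>x. (x, real n)) -` E" for E :: "('a \<times> real) set" and n
  have lev: "convex (lev E n)" "closed (lev E n)" "bounded (lev E n)" "incseq (lev E)"
    if E: "convex E" "closed E" "\<And>x r s. (x, r) \<in> E \<Longrightarrow> r \<le> s \<Longrightarrow> (x, s) \<in> E" for E n
  proof -
    show "convex (lev E n)"
    proof (rule convexI)
      fix x y and u v :: real
      assume xy: "x \<in> lev E n" "y \<in> lev E n" and uv: "0 \<le> u" "0 \<le> v" "u + v = 1"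
      have "u *\<^sub>R (x, real n) + v *\<^sub>R (y, real n) \<in> E"
        using xy uv by (intro convexD[OF E(1)]) (auto simp: lev_def)
      moreover have "u * real n + v * real n = real n"
        using uv by (simp flip: distrib_right)
      moreover have "u *\<^sub>R x + v *\<^sub>R y \<in> cball 0 (real n)"
        using xy uv by (intro convexD[OF convex_cball]) (auto simp: lev_def)
      ultimately show "u *\<^sub>R x + v *\<^sub>R y \<in> lev E n" by (simp add: lev_def)
    qed
    show "closed (lev E n)"
      unfolding lev_def using E(2) by (intro closed_Int closed_cball closed_vimage continuous_intros)
    show "bounded (lev E n)" by (auto simp: lev_def intro: bounded_subset[OF bounded_cball])
    show "incseq (lev E)" by (auto simp: incseq_def lev_def intro: E(3)[OF _ of_nat_mono])
  qed
  have UN: "\<exists>n. u \<in> {x - y | x y. x \<in> lev C n \<and> y \<in> lev D n}" for u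
  proof -
    obtain x r y s where xy: "(x, r) \<in> C" "(y, s) \<in> D" "u = x - y" using total by blast
    obtain n where "max (max (norm x) (norm y)) (max r s) \<le> real n" using real_arch_simple by blast
    then have "x \<in> lev C n" "y \<in> lev D n"
      using xy C(3) D(3) by (auto simp: lev_def)
    with xy show ?thesis by blast
  qed
  obtain n e where e: "e > 0" "ball 0 e \<subseteq> {x - y | x y. x \<in> lev C n \<and> y \<in> lev D n}"
    
  proof (rule ball_subset_convex_difference[of "lev C" "lev D"])
    show "convex (lev C m)" "closed (lev C m)" "bounded (lev C m)" "incseq (lev C)" for m
      by (rule lev[OF C]; assumption)+
    show "convex (lev D m)" "closed (lev D m)" "bounded (lev D m)" "incseq (lev D)" for m
      by (rule lev[OF D]; assumption)+
  qed (rule UN)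
  have bnd: "L u \<le> 2 * real n" if "norm u < e" for u
  proof -
    have "u \<in> ball 0 e" using that by simp
    then obtain x y where "x \<in> lev C n" "y \<in> lev D n" "u = x - y" using e(2) by blast
    then show ?thesis using LK[OF KI, of x "real n" y "real n"] by (simp add: lev_def)
  qed
  \<comment> \<open>Scaling \<open>u\<close> to norm \<open>e / 2\<close> and applying the bound
    \<open>2 * real n\<close> yields the constant \<open>4 * real n / e\<close>.\<close>
  have le: "L u \<le> norm u * (4 * real n / e)" for u
  proof (cases "u = 0")
    case False
    then have "L ((e / (2 * norm u)) *\<^sub>R u) \<le> 2 * real n" using e(1) by (intro bnd) simp
    then show ?thesis using False e(1) by (simp add: linear_cmul[OF L] field_simps)
  qed (simp add: linear_0[OF L])
  have "bounded_linear L"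
  proof (rule bounded_linear_intro)
    show "norm (L u) \<le> norm u * (4 * real n / e)" for u
      using le[of u] le[of "- u"] by (simp add: linear_neg[OF L] abs_le_iff)
  qed (simp_all add: linear_add[OF L] linear_cmul[OF L])
  then show ?thesis using LK KI that by blast
qed

section \<open>Representation of functionals by reflexivity\<close>

lemma reflexive_space_bidual:
  fixes G :: "('a::real_normed_vector \<Rightarrow>\<^sub>L real) \<Rightarrow> real"
  assumes "reflexive_space TYPE('a)" and "bounded_linear G"
  obtains x :: 'a where "\<And>f. G f = blinfun_apply f x"
proof -
  obtain x :: 'a where x: "Blinfun G = Blinfun (\<lambda>f. blinfun_apply f x)"
    using assms(1) unfolding reflexive_space_def surj_def by blast
  have "G f = blinfun_apply f x" for f
    using arg_cong[OF x, of "\<lambda>b. blinfun_apply b f"] assms(2)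
    by (simp add: bounded_linear_Blinfun_apply blinfun.bounded_linear_left)
  then show ?thesis by (rule that)
qed

text \<open>The functional splits into its restrictions to the two factors: reflexivity represents
  the first by a point, and the second is itself an element of the dual.\<close>

lemma bounded_linear_prod_reflexive:
  fixes L :: "('a::real_normed_vector \<Rightarrow>\<^sub>L real) \<times> 'a \<Rightarrow> real"
  assumes "reflexive_space TYPE('a)" and L: "bounded_linear L"
  obtains x' y' where "\<And>y x. L (y, x) = blinfun_apply y x' + blinfun_apply y' x"
proof -
  have "bounded_linear (\<lambda>y. L (y, 0))"
    by (intro bounded_linear_compose[OF L] bounded_linear_Pair bounded_linear_ident bounded_linear_zero)
  then obtain x' where x': "\<And>y. L (y, 0) = blinfun_apply y x'"
    using reflexive_space_bidual[OF assms(1)] by blast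
  have R: "bounded_linear (\<lambda>x. L (0, x))"
    by (intro bounded_linear_compose[OF L] bounded_linear_Pair bounded_linear_ident bounded_linear_zero)
  have "L (y, x) = blinfun_apply y x' + blinfun_apply (Blinfun (\<lambda>x. L (0, x))) x" for y x
    using linear_add[OF bounded_linear.linear[OF L], of "(y, 0)" "(0, x)"]
    by (simp add: x' bounded_linear_Blinfun_apply[OF R])
  then show ?thesis by (rule that)
qed

section \<open>Fitzpatrick functions and their epigraphs\<close>

text \<open>Fitzpatrick functions are suprema of continuous affine functions, so their epigraphs are
  intersections of closed half-spaces.\<close>

lemma convex_closed_affine_epigraph:
  fixes l :: "'i \<Rightarrow> 'a::real_normed_vector \<Rightarrow> real"
  assumes "\<And>i. bounded_linear (l i)"
  shows "convex {(x, r). \<forall>i\<in>I. l i x + c i \<le> r}" (is "convex ?E")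
    and "closed {(x, r). \<forall>i\<in>I. l i x + c i \<le> r}"
proof -
  show "convex ?E"
  proof (rule convexI)
    fix p q and u v :: real
    assume pq: "p \<in> ?E" "q \<in> ?E" and uv: "0 \<le> u" "0 \<le> v" "u + v = 1"
    have "l i (u *\<^sub>R fst p + v *\<^sub>R fst q) + c i \<le> u * snd p + v * snd q" if "i \<in> I" for i
    proof -
      have "u * (l i (fst p) + c i) + v * (l i (fst q) + c i) \<le> u * snd p + v * snd q"
        using pq uv that by (intro add_mono mult_left_mono) auto
      moreover have "u * c i + v * c i = c i" using uv by (simp flip: distrib_right)
      ultimately show ?thesis
        using linear_add[OF bounded_linear.linear[OF assms]] linear_cmul[OF bounded_linear.linear[OF assms]]
        by (simp add: algebra_simps)
    qed
    then show "u *\<^sub>R p + v *\<^sub>R q \<in> ?E" by (auto simp: case_prod_beta)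
  qed
  have "?E = (\<Inter>i\<in>I. {z. l i (fst z) + c i \<le> snd z})" by auto
  also have "closed \<dots>"
    by (intro closed_INT ballI closed_Collect_le bounded_linear.continuous_on[OF assms] continuous_intros)
  finally show "closed ?E" .
qed

text \<open>Translates monotonicity into a bound on one term of the Fitzpatrick supremum; the
  comparisons of \<open>fitzS\<close> and \<open>fitzT\<close> with the pairing rest on it.\<close>

lemma blinfun_diff_diff_nonneg_iff:
  fixes y ss :: "'a::real_normed_vector \<Rightarrow>\<^sub>L real"
  shows "blinfun_apply (y - ss) (x - s) \<ge> 0 \<longleftrightarrow>
    blinfun_apply ss x + blinfun_apply y s - blinfun_apply ss s \<le> blinfun_apply y x"
  by (auto simp: blinfun.diff_left blinfun.diff_right)

lemma fitzS_le_iff: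
  "fitzS S x y \<le> ereal r \<longleftrightarrow>
    (\<forall>s ss. ss \<in> S s \<longrightarrow> blinfun_apply ss x + blinfun_apply y s - blinfun_apply ss s \<le> r)"
  unfolding fitzS_def graphS_def by (auto simp: SUP_le_iff)

lemma fitzT_le_iff:
  "fitzT T y x \<le> ereal r \<longleftrightarrow>
    (\<forall>ts t. t \<in> T ts \<longrightarrow> blinfun_apply ts x + blinfun_apply y t - blinfun_apply ts t \<le> r)"
  unfolding fitzT_def graphT_def by (auto simp: SUP_le_iff)

lemma edom_le:
  assumes "(a, b) \<in> edom f"
  obtains r where "f a b \<le> ereal r"
  using assms unfolding edom_def by (cases "f a b") auto

lemma max_monotoneSI:
  assumes "max_monotoneS S"
    and "\<And>s ss. ss \<in> S s \<Longrightarrow> blinfun_apply (y - ss) (x - s) \<ge> 0"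
  shows "y \<in> S x"
  using assms unfolding max_monotoneS_def graphS_def by blast

lemma max_monotoneTI:
  assumes "max_monotoneT T"
    and "\<And>ts t. t \<in> T ts \<Longrightarrow> blinfun_apply (y - ts) (x - t) \<ge> 0"
  shows "x \<in> T y"
  using assms unfolding max_monotoneT_def graphT_def by blast

text \<open>On the graph, the term of the supremum at \<open>(x, y)\<close> itself is the pairing.
  Off the graph, maximality supplies a graph point whose term exceeds the pairing.\<close>

lemma fitzS_ge:
  assumes "max_monotoneS S" and r: "fitzS S x y \<le> ereal r"
  shows "blinfun_apply y x \<le> r"
proof (cases "y \<in> S x")
  case True
  then have "blinfun_apply y x + blinfun_apply y x - blinfun_apply y x \<le> r"
    using r unfolding fitzS_le_iff by blast
  then show ?thesis by simp
next
  case False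
  then obtain s ss where s: "ss \<in> S s" "\<not> blinfun_apply (y - ss) (x - s) \<ge> 0"
    using max_monotoneSI[OF assms(1)] by blast
  have "blinfun_apply ss x + blinfun_apply y s - blinfun_apply ss s \<le> r"
    using r s(1) unfolding fitzS_le_iff by blast
  with s(2) show ?thesis unfolding blinfun_diff_diff_nonneg_iff by linarith
qed

lemma fitzT_ge:
  assumes "max_monotoneT T" and r: "fitzT T y x \<le> ereal r"
  shows "blinfun_apply y x \<le> r"
proof (cases "x \<in> T y")
  case True
  then have "blinfun_apply y x + blinfun_apply y x - blinfun_apply y x \<le> r"
    using r unfolding fitzT_le_iff by blast
  then show ?thesis by simp
next
  case False
  then obtain ts t where s: "t \<in> T ts" "\<not> blinfun_apply (y - ts) (x - t) \<ge> 0"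
    using max_monotoneTI[OF assms(1)] by blast
  have "blinfun_apply ts x + blinfun_apply y t - blinfun_apply ts t \<le> r"
    using r s(1) unfolding fitzT_le_iff by blast
  with s(2) show ?thesis unfolding blinfun_diff_diff_nonneg_iff by linarith
qed

text \<open>By monotonicity every term is at most the pairing. This provides the epigraph points at
  which the separating functional is later evaluated.\<close>

lemma fitzS_graph:
  assumes "max_monotoneS S" "y \<in> S x"
  shows "fitzS S x y \<le> ereal (blinfun_apply y x)"
proof -
  have "blinfun_apply (y - ss) (x - s) \<ge> 0" if "ss \<in> S s" for s ss
    using assms that unfolding max_monotoneS_def monotoneS_def graphS_def by blast
  then show ?thesis
    unfolding fitzS_le_iff blinfun_diff_diff_nonneg_iff by blast
qed

lemma fitzT_graph:
  assumes "max_monotoneT T" "x \<in> T y"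
  shows "fitzT T y x \<le> ereal (blinfun_apply y x)"
proof -
  have "blinfun_apply (y - ts) (x - t) \<ge> 0" if "t \<in> T ts" for ts t
    using assms that unfolding max_monotoneT_def monotoneT_def graphT_def by blast
  then show ?thesis
    unfolding fitzT_le_iff blinfun_diff_diff_nonneg_iff by blast
qed

section \<open>Surjectivity of the sum of the identity and \<open>TS\<close>\<close>

theorem theorem7p6:
  fixes S :: "'a::banach \<Rightarrow> ('a \<Rightarrow>\<^sub>L real) set"
    and T :: "('a \<Rightarrow>\<^sub>L real) \<Rightarrow> 'a set"
  assumes nonzero: "\<exists>x::'a. x \<noteq> 0"
    and refl: "reflexive_space TYPE('a)"
    and S: "max_monotoneS S"
    and T: "max_monotoneT T"
    and cond: "(fst ` edom (fitzT T) = UNIV \<and> (\<exists>ws. UNIV \<times> {ws} \<subseteq> edom (fitzS S)))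
             \<or> (fst ` edom (fitzS S) = UNIV \<and> (\<exists>w. UNIV \<times> {w} \<subseteq> edom (fitzT T)))"
  shows "range_I_plus_TS S T = UNIV"
proof -
  have "x0 \<in> range_I_plus_TS S T" for x0
  proof -
    \<comment> \<open>\<open>C\<close> and \<open>D\<close> are the epigraphs of \<open>f\<close>
      and \<open>g\<close>, with the dual coordinate first. In \<open>D\<close> the term
      \<open>blinfun_apply y x0\<close> is moved to the right, where it is a real summand.\<close>
    define C where "C = {((y, x), r). fitzS S x y \<le> ereal r}"
    define D where "D = {((y, x), r). fitzT T y (x0 - x) \<le> ereal (r + blinfun_apply y x0)}"
    have C_eq: "C = {(z, r). \<forall>i\<in>graphS S. (blinfun_apply (snd i) (snd z) + blinfun_apply (fst z) (fst i))
        + (- blinfun_apply (snd i) (fst i)) \<le> r}"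
      by (auto simp: C_def fitzS_le_iff graphS_def)
    have D_eq: "D = {(z, r). \<forall>i\<in>graphT T.
        (blinfun_apply (fst z) (snd i - x0) - blinfun_apply (fst i) (snd z))
        + (blinfun_apply (fst i) x0 - blinfun_apply (fst i) (snd i)) \<le> r}"
      by (auto simp: D_def fitzT_le_iff graphT_def blinfun.diff_right algebra_simps split: prod.splits)
    have lin: "bounded_linear (\<lambda>z :: ('a \<Rightarrow>\<^sub>L real) \<times> 'a. blinfun_apply f (snd z))"
      "bounded_linear (\<lambda>z :: ('a \<Rightarrow>\<^sub>L real) \<times> 'a. blinfun_apply (fst z) a)" for f and a :: 'a
      by (intro bounded_linear_compose[OF blinfun.bounded_linear_right] bounded_linear_snd
          bounded_linear_compose[OF blinfun.bounded_linear_left] bounded_linear_fst)+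
    have C: "convex C" "closed C"
      unfolding C_eq by (intro convex_closed_affine_epigraph bounded_linear_add lin)+
    have D: "convex D" "closed D"
      unfolding D_eq by (intro convex_closed_affine_epigraph bounded_linear_sub lin)+
    have up: "(z, s) \<in> C" if "(z, r) \<in> C" "r \<le> s" for z r s
      using that unfolding C_def by (auto elim: order_trans)
    have up': "(z, s) \<in> D" if "(z, r) \<in> D" "r \<le> s" for z r s
      using that unfolding D_def by (auto elim: order_trans)
    have nonneg: "r + s \<ge> 0" if "(z, r) \<in> C" "(z, s) \<in> D" for z r s
    proof -
      obtain y x where z: "z = (y, x)" by (cases z)
      have "blinfun_apply y x \<le> r"
        using that(1) by (intro fitzS_ge[OF S]) (simp add: C_def z)
      moreover have "blinfun_apply y (x0 - x) \<le> s + blinfun_apply y x0"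
        using that(2) by (intro fitzT_ge[OF T]) (simp add: D_def z)
      ultimately show ?thesis by (simp add: blinfun.diff_right)
    qed
    have total: "\<exists>p r q s. (p, r) \<in> C \<and> (q, s) \<in> D \<and> u = p - q" for u
    proof -
      have "\<exists>y x y' x'. (x, y) \<in> edom (fitzS S) \<and> (y', x') \<in> edom (fitzT T) \<and>
          fst u = y - y' \<and> snd u = x - (x0 - x')"
        using cond
      proof (elim disjE conjE exE)
        \<comment> \<open>Fixing \<open>y = ws\<close> forces \<open>y' = ws - fst u\<close>. The
          projection hypothesis supplies \<open>x'\<close>, and the resulting \<open>x\<close> is
          admissible because every point is paired with \<open>ws\<close>.\<close>
        fix ws assume T': "fst ` edom (fitzT T) = UNIV" and S': "UNIV \<times> {ws} \<subseteq> edom (fitzS S)"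
        have "ws - fst u \<in> fst ` edom (fitzT T)" using T' by simp
        then obtain x' where x': "(ws - fst u, x') \<in> edom (fitzT T)" by auto
        have "(snd u + (x0 - x'), ws) \<in> edom (fitzS S)" using S' by auto
        with x' show ?thesis
          by (intro exI[of _ ws] exI[of _ "snd u + (x0 - x')"] exI[of _ "ws - fst u"] exI[of _ x']) auto
      next
        \<comment> \<open>Mirror image: fixing \<open>x' = w\<close> forces \<open>x\<close>, the
          projection hypothesis supplies \<open>y\<close>, and \<open>y' = y - fst u\<close> is
          admissible with \<open>w\<close>.\<close>
        fix w assume S': "fst ` edom (fitzS S) = UNIV" and T': "UNIV \<times> {w} \<subseteq> edom (fitzT T)"
        have "snd u + (x0 - w) \<in> fst ` edom (fitzS S)" using S' by simp
        then obtain y where y: "(snd u + (x0 - w), y) \<in> edom (fitzS S)" by auto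
        have "(y - fst u, w) \<in> edom (fitzT T)" using T' by auto
        with y show ?thesis
          by (intro exI[of _ y] exI[of _ "snd u + (x0 - w)"] exI[of _ "y - fst u"] exI[of _ w]) auto
      qed
      then obtain y x y' x' where xy: "(x, y) \<in> edom (fitzS S)" "(y', x') \<in> edom (fitzT T)"
        and u: "fst u = y - y'" "snd u = x - (x0 - x')" by blast
      obtain r where r: "fitzS S x y \<le> ereal r" using xy(1) by (rule edom_le)
      obtain s where s: "fitzT T y' x' \<le> ereal s" using xy(2) by (rule edom_le)
      have "((y, x), r) \<in> C" using r by (simp add: C_def)
      moreover have "((y', x0 - x'), s - blinfun_apply y' x0) \<in> D" using s by (simp add: D_def)
      moreover have "u = (y, x) - (y', x0 - x')" using u by (simp add: prod_eq_iff)
      ultimately show ?thesis by blast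
    qed
    obtain L where L: "bounded_linear L"
      and LCD: "\<And>p r q s. (p, r) \<in> C \<Longrightarrow> (q, s) \<in> D \<Longrightarrow> L (p - q) \<le> r + s"
    proof (rule fenchel_separation[OF C _ D])
      show "(x, s) \<in> C" if "(x, r) \<in> C" "r \<le> s" for x r s using that by (rule up)
      show "(x, s) \<in> D" if "(x, r) \<in> D" "r \<le> s" for x r s using that by (rule up')
      show "r + s \<ge> 0" if "(x, r) \<in> C" "(x, s) \<in> D" for x r s using that by (rule nonneg)
      show "\<exists>p r q s. (p, r) \<in> C \<and> (q, s) \<in> D \<and> u = p - q" for u by (rule total)
    qed (rule that)
    obtain x y where Lxy: "\<And>b a. L (b, a) = blinfun_apply b x + blinfun_apply y a"
      using bounded_linear_prod_reflexive[OF refl L] by blast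
    \<comment> \<open>The left side is exactly the right side minus the left side of the
      \<open>LCD\<close> inequality at these graph points; the terms
      \<open>blinfun_apply y x\<close> cancel.\<close>
    have key: "blinfun_apply (y - ss) (x - s) + blinfun_apply (y - ts) (x0 - x - t) \<ge> 0"
      if "ss \<in> S s" "t \<in> T ts" for s ss t ts
    proof -
      have "((ss, s), blinfun_apply ss s) \<in> C"
        using fitzS_graph[OF S that(1)] by (simp add: C_def)
      moreover have "((ts, x0 - t), blinfun_apply ts t - blinfun_apply ts x0) \<in> D"
        using fitzT_graph[OF T that(2)] by (simp add: D_def)
      ultimately have "L ((ss, s) - (ts, x0 - t)) \<le> blinfun_apply ss s + (blinfun_apply ts t - blinfun_apply ts x0)"
        by (rule LCD)
      then show ?thesis
        by (simp add: Lxy blinfun.diff_left blinfun.diff_right blinfun.add_right algebra_simps)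
    qed
    \<comment> \<open>A graph point of \<open>S\<close> with negative first summand makes the second
      positive on the whole graph of \<open>T\<close>, so maximality puts \<open>(y, x0 - x)\<close>
      on that graph. There the second summand vanishes, contradicting \<open>key\<close>.\<close>
    have Sxy: "y \<in> S x"
    proof (rule ccontr)
      assume "y \<notin> S x"
      then obtain s ss where s: "ss \<in> S s" "blinfun_apply (y - ss) (x - s) < 0"
        using max_monotoneSI[OF S] by (meson not_le)
      have "x0 - x \<in> T y"
        using key[OF s(1)] s(2) by (intro max_monotoneTI[OF T]) (smt (verit))
      from key[OF s(1) this] s(2) show False by simp
    qed
    \<comment> \<open>Choosing \<open>(x, y)\<close> as the graph point of \<open>S\<close> makes
      the first summand of \<open>key\<close> zero.\<close>
    have "x0 - x \<in> T y"
      using key[OF Sxy] by (intro max_monotoneTI[OF T]) simp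
    moreover have "x0 = x + (x0 - x)" by simp
    ultimately show ?thesis
      using Sxy unfolding range_I_plus_TS_def by blast
  qed
  then show ?thesis by blast
qed

end
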